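(* Let $n\ge2$, let $x_0\in\mathbf{R}^n$ be a unit vector, let $A_I\in\mathbf{R}^{N_I\times n}$, and let $b_I=|A_Ix_0|$ (so that $\|b_I\|=\|A_Ix_0\|$). Let $x_{min}$ be a unit right singular vector of $A_I$ corresponding to its least singular value, i.e. a minimizer of $\|A_Ix\|$ over unit vectors $x\in\mathbf{R}^n$, with sign chosen so that $x_0\cdot x_{min}\ge0$, and let $\alpha_1=|x_0\cdot x_{min}|$. Let $w$ be a unit vector orthogonal to $x_{min}$ such that $$x_0=\alpha_1x_{min}+\sqrt{1-\alpha_1^2}\,w,$$ and let $$x_1=-\sqrt{1-\alpha_1^2}\,x_{min}+\alpha_1w,$$ a unit vector orthogonal to $x_0$. Then $$(2-\alpha_1^2)\,\|b_I\|^2\ \ge\ (1-\alpha_1^2)\,\|A_Ix_1\|^2 .$$ Moreover, if $A_Ix_1\neq0$, $$\|b_I\|^2\,\|A_Ix_1\|^{-2}\ \ge\ \frac{1-\alpha_1^2}{2-\alpha_1^2}\ \ge\ \frac12\,\|x_0x_0^\top-x_{min}x_{min}^\top\|^2 .$$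
   Context: $\|\cdot\|$ is the Euclidean norm for vectors and the spectral norm for matrices; $|\cdot|$ of a vector is the entrywise absolute value. In the paper, $A_I$ is the submatrix of a sensing matrix $A\in\mathbf{R}^{N\times n}$ formed by the rows $a_i$, $i\in I$, where $I$ is the set of indices of the $N_I$ smallest values among $b_i=|a_i\cdot x_0|$, $i=1,\dots,N$, and $b_I=(b_i)_{i\in I}$. *)

theory Defs
  imports "HOL-Analysis.Analysis"
begin

(* The library norm on real^'n^'m is the Frobenius norm, so the spectral norm
   is taken as the operator norm for the Euclidean norms on both sides. *)
definition spectral_norm :: "real^'n^'m \<Rightarrow> real" where
  "spectral_norm M = onorm (\<lambda>x. M *v x)"

definition outer :: "real^'m \<Rightarrow> real^'n \<Rightarrow> real^'n^'m" where
  "outer x y = (columnvector x :: real^1^'m) ** (rowvector y :: real^'n^1)"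

(* The least singular value is the minimum of norm (A *v x) over unit vectors x;
   in particular it is 0 when A has fewer rows than columns. *)
definition least_right_singular_vector :: "real^'n^'m \<Rightarrow> real^'n \<Rightarrow> bool" where
  "least_right_singular_vector A v \<longleftrightarrow>
     norm v = 1 \<and> (\<forall>x. norm x = 1 \<longrightarrow> norm (A *v v) \<le> norm (A *v x))"

end

theory Submission
  imports Defs
begin

text \<open>
  Write \<open>m\<close> for the minimizer \<open>x_min\<close>, \<open>c = \<alpha>\<^sub>1\<close>, \<open>s = sqrt (1 - \<alpha>\<^sub>1\<^sup>2)\<close>. The vectors \<open>x\<^sub>0\<close> and
  \<open>x\<^sub>1\<close> arise from the orthonormal pair \<open>m\<close>, \<open>w\<close> by a plane rotation. The first-order optimality
  condition of the minimum says that \<open>A m\<close> and \<open>A w\<close> are orthogonal as well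
  (\<open>least_right_singular_vector_image_orthogonal\<close>). So, with \<open>p = \<parallel>A m\<parallel>\<^sup>2\<close> and \<open>q = \<parallel>A w\<parallel>\<^sup>2\<close>,
  Pythagoras gives \<open>\<parallel>A x\<^sub>0\<parallel>\<^sup>2 = c\<^sup>2 p + s\<^sup>2 q\<close> and \<open>\<parallel>A x\<^sub>1\<parallel>\<^sup>2 = s\<^sup>2 p + c\<^sup>2 q\<close>, and the first
  inequality follows from the identity
  \<open>(1 + s\<^sup>2) (c\<^sup>2 p + s\<^sup>2 q) - s\<^sup>2 (s\<^sup>2 p + c\<^sup>2 q) = p + 2 s\<^sup>4 (q - p)\<close>,
  whose right-hand side is nonnegative because minimality of \<open>m\<close> means \<open>p \<le> q\<close>.

  For the last inequality, the difference of the two rank-one projections vanishes on the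
  orthogonal complement of the plane spanned by \<open>m\<close> and \<open>w\<close>, and on this plane it is \<open>s\<close> times an
  isometry. Hence its spectral norm is at most \<open>s\<close> (\<open>spectral_norm_outer_diff_le\<close>), and
  \<open>s\<^sup>2 / 2 \<le> s\<^sup>2 / (1 + s\<^sup>2)\<close> because \<open>s \<le> 1\<close>.
\<close>

lemma norm_abs_vec: "norm \<bar>v\<bar> = norm (v :: real^'m)"
  by (simp add: norm_vec_def abs_vec_def)

lemma outer_mult_vec: "outer x y *v z = (y \<bullet> z) *\<^sub>R x"
  by (simp add: outer_def vec_eq_iff matrix_vector_mult_def matrix_matrix_mult_def
      columnvector_def rowvector_def inner_vec_def sum_distrib_left sum_distrib_right
      mult.assoc mult.commute mult.left_commute)

lemma norm_sq_lincomb: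
  fixes u v :: "'a::real_inner"
  shows "(norm (a *\<^sub>R u + b *\<^sub>R v))\<^sup>2
    = a\<^sup>2 * (norm u)\<^sup>2 + b\<^sup>2 * (norm v)\<^sup>2 + 2 * a * b * (u \<bullet> v)"
  unfolding power2_norm_eq_inner
  by (simp add: inner_add_left inner_add_right inner_commute[of v u] power2_eq_square algebra_simps)

lemma least_right_singular_vector_le:
  assumes "least_right_singular_vector A v"
  shows "norm (A *v v) * norm x \<le> norm (A *v x)"
proof (cases "x = 0")
  case False
  have "norm (A *v v) \<le> norm (A *v ((1 / norm x) *\<^sub>R x))"
    using assms False by (simp add: least_right_singular_vector_def)
  also have "\<dots> = norm (A *v x) / norm x"
    by (simp add: matrix_vector_mult_scaleR)
  finally show ?thesis
    using False by (simp add: field_simps)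
qed simp

text \<open>
  A quadratic without constant term has a simple root at \<open>0\<close> unless its linear coefficient
  vanishes, so it changes sign there; this is the first-order condition for a minimum at \<open>0\<close>.
\<close>
lemma nonneg_quadratic_imp_linear_coeff_zero:
  fixes r d :: real
  assumes nonneg: "\<And>t. 0 \<le> 2 * t * r + t\<^sup>2 * d"
  shows "r = 0"
proof -
  define k where "k = \<bar>d\<bar> + 1"
  have k: "k > 0" "d - 2 * k < 0"
    by (auto simp: k_def)
  \<comment> \<open>The vertex of the parabola with leading coefficient \<open>k > d\<close>.\<close>
  have "0 \<le> 2 * (- r / k) * r + (- r / k)\<^sup>2 * d"
    by (rule nonneg)
  also have "\<dots> = (r / k)\<^sup>2 * (d - 2 * k)"
    using k by (simp add: power2_eq_square field_simps)
  finally have "(r / k)\<^sup>2 \<le> 0"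
    using k by (simp add: zero_le_mult_iff)
  then show ?thesis
    using k by simp
qed

text \<open>
  Perturbing the minimizer \<open>v\<close> to \<open>v + t w\<close> changes \<open>\<parallel>A x\<parallel>\<^sup>2 - \<parallel>A v\<parallel>\<^sup>2 \<parallel>x\<parallel>\<^sup>2\<close>, which is
  minimal with value \<open>0\<close> at \<open>v\<close>, to first order by \<open>2 t (A v \<bullet> A w)\<close>.
\<close>
lemma least_right_singular_vector_image_orthogonal:
  assumes min: "least_right_singular_vector A v" and orth: "v \<bullet> w = 0"
  shows "(A *v v) \<bullet> (A *v w) = 0"
proof (rule nonneg_quadratic_imp_linear_coeff_zero)
  fix t :: real
  let ?x = "1 *\<^sub>R v + t *\<^sub>R w"
  have "(norm (A *v v) * norm ?x)\<^sup>2 \<le> (norm (A *v ?x))\<^sup>2"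
    by (intro power_mono least_right_singular_vector_le[OF min]) simp
  moreover have "A *v ?x = 1 *\<^sub>R (A *v v) + t *\<^sub>R (A *v w)"
    by (simp add: matrix_vector_right_distrib matrix_vector_mult_scaleR)
  moreover have "norm v = 1"
    using min by (simp add: least_right_singular_vector_def)
  ultimately show "0 \<le> 2 * t * ((A *v v) \<bullet> (A *v w))
      + t\<^sup>2 * ((norm (A *v w))\<^sup>2 - (norm (A *v v))\<^sup>2 * (norm w)\<^sup>2)"
    using orth by (simp only: power_mult_distrib norm_sq_lincomb) (simp add: algebra_simps)
qed

lemma bessel_pair:
  fixes m w y :: "'a::real_inner"
  assumes "norm m = 1" "norm w = 1" "m \<bullet> w = 0"
  shows "(m \<bullet> y)\<^sup>2 + (w \<bullet> y)\<^sup>2 \<le> (norm y)\<^sup>2"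
proof -
  define z where "z = (m \<bullet> y) *\<^sub>R m + (w \<bullet> y) *\<^sub>R w"
  have "(norm z)\<^sup>2 = (m \<bullet> y)\<^sup>2 + (w \<bullet> y)\<^sup>2"
    using assms by (simp add: z_def norm_sq_lincomb)
  moreover have "z \<bullet> y = (m \<bullet> y)\<^sup>2 + (w \<bullet> y)\<^sup>2"
    by (simp add: z_def inner_add_left power2_eq_square)
  moreover have "0 \<le> (norm (y - z))\<^sup>2"
    by simp
  moreover have "(norm (y - z))\<^sup>2 = (norm y)\<^sup>2 + (norm z)\<^sup>2 - 2 * (z \<bullet> y)"
    using norm_sq_lincomb[of 1 y "-1" z] by (simp add: inner_commute)
  ultimately show ?thesis
    by simp
qed

text \<open>
  In the coordinates \<open>m \<bullet> y\<close>, \<open>w \<bullet> y\<close> the difference of the projections onto \<open>c m + s w\<close> and onto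
  \<open>m\<close> is the symmetric matrix with rows \<open>(-s\<^sup>2, c s)\<close> and \<open>(c s, s\<^sup>2)\<close>, which has trace \<open>0\<close> and
  determinant \<open>-s\<^sup>2\<close>, hence eigenvalues \<open>s\<close> and \<open>-s\<close>.
\<close>
lemma spectral_norm_outer_diff_le:
  fixes m w :: "real^'n"
  assumes ortho: "norm m = 1" "norm w = 1" "m \<bullet> w = 0" and circle: "c\<^sup>2 + s\<^sup>2 = 1" and "0 \<le> s"
  defines "x \<equiv> c *\<^sub>R m + s *\<^sub>R w"
  shows "spectral_norm (outer x x - outer m m) \<le> s"
  unfolding spectral_norm_def
proof (rule onorm_le)
  fix y :: "real^'n"
  define a b where "a = m \<bullet> y" and "b = w \<bullet> y"
  have xy: "x \<bullet> y = c * a + s * b"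
    by (simp add: x_def a_def b_def inner_add_left)
  have "(outer x x - outer m m) *v y = (x \<bullet> y) *\<^sub>R x - a *\<^sub>R m"
    by (simp add: matrix_vector_mult_diff_rdistrib outer_mult_vec a_def)
  also have "\<dots> = ((c * a + s * b) * c - a) *\<^sub>R m + ((c * a + s * b) * s) *\<^sub>R w"
    unfolding xy by (simp add: x_def algebra_simps)
  finally have "(norm ((outer x x - outer m m) *v y))\<^sup>2
      = ((c * a + s * b) * c - a)\<^sup>2 + ((c * a + s * b) * s)\<^sup>2"
    using ortho by (simp add: norm_sq_lincomb)
  also have "\<dots> = s\<^sup>2 * (a\<^sup>2 + b\<^sup>2)"
    using circle by algebra
  also have "\<dots> \<le> s\<^sup>2 * (norm y)\<^sup>2"
    unfolding a_def b_def by (intro mult_left_mono bessel_pair ortho) simp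
  finally show "norm ((outer x x - outer m m) *v y) \<le> s * norm y"
    using \<open>0 \<le> s\<close> by (simp flip: power_mult_distrib)
qed

theorem proposition2p4:
  fixes A\<^sub>I :: "real^'n^'m"
    and b\<^sub>I :: "real^'m"
    and x\<^sub>0 x_min w x\<^sub>1 :: "real^'n"
    and \<alpha>\<^sub>1 :: real
  assumes "CARD('n) \<ge> 2"
    and "norm x\<^sub>0 = 1"
    and "b\<^sub>I = \<bar>A\<^sub>I *v x\<^sub>0\<bar>"
    and "least_right_singular_vector A\<^sub>I x_min"
    and "x\<^sub>0 \<bullet> x_min \<ge> 0"
    and "\<alpha>\<^sub>1 = \<bar>x\<^sub>0 \<bullet> x_min\<bar>"
    and "norm w = 1"
    and "w \<bullet> x_min = 0"
    and "x\<^sub>0 = \<alpha>\<^sub>1 *\<^sub>R x_min + sqrt (1 - \<alpha>\<^sub>1\<^sup>2) *\<^sub>R w"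
    and "x\<^sub>1 = - sqrt (1 - \<alpha>\<^sub>1\<^sup>2) *\<^sub>R x_min + \<alpha>\<^sub>1 *\<^sub>R w"
  shows "norm b\<^sub>I = norm (A\<^sub>I *v x\<^sub>0) \<and> norm x\<^sub>1 = 1 \<and> x\<^sub>1 \<bullet> x\<^sub>0 = 0 \<and>
    (2 - \<alpha>\<^sub>1\<^sup>2) * (norm b\<^sub>I)\<^sup>2 \<ge> (1 - \<alpha>\<^sub>1\<^sup>2) * (norm (A\<^sub>I *v x\<^sub>1))\<^sup>2 \<and>
    (A\<^sub>I *v x\<^sub>1 \<noteq> 0 \<longrightarrow>
      (norm b\<^sub>I)\<^sup>2 * norm (A\<^sub>I *v x\<^sub>1) powi (-2) \<ge> (1 - \<alpha>\<^sub>1\<^sup>2) / (2 - \<alpha>\<^sub>1\<^sup>2) \<and>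
      (1 - \<alpha>\<^sub>1\<^sup>2) / (2 - \<alpha>\<^sub>1\<^sup>2) \<ge>
        1 / 2 * (spectral_norm (outer x\<^sub>0 x\<^sub>0 - outer x_min x_min))\<^sup>2)"
proof -
  define s where "s = sqrt (1 - \<alpha>\<^sub>1\<^sup>2)"
  define p where "p = (norm (A\<^sub>I *v x_min))\<^sup>2"
  define q where "q = (norm (A\<^sub>I *v w))\<^sup>2"
  note min = \<open>least_right_singular_vector A\<^sub>I x_min\<close>
  note x0 = \<open>x\<^sub>0 = \<alpha>\<^sub>1 *\<^sub>R x_min + sqrt (1 - \<alpha>\<^sub>1\<^sup>2) *\<^sub>R w\<close>[folded s_def]
  note x1 = \<open>x\<^sub>1 = - sqrt (1 - \<alpha>\<^sub>1\<^sup>2) *\<^sub>R x_min + \<alpha>\<^sub>1 *\<^sub>R w\<close>[folded s_def]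
  have m: "norm x_min = 1"
    using min by (simp add: least_right_singular_vector_def)
  have mw: "x_min \<bullet> w = 0"
    using \<open>w \<bullet> x_min = 0\<close> by (simp add: inner_commute)
  have "\<alpha>\<^sub>1 \<le> 1"
    using Cauchy_Schwarz_ineq2[of x\<^sub>0 x_min] m \<open>norm x\<^sub>0 = 1\<close> \<open>\<alpha>\<^sub>1 = \<bar>x\<^sub>0 \<bullet> x_min\<bar>\<close> by simp
  then have "\<alpha>\<^sub>1\<^sup>2 \<le> 1"
    using \<open>\<alpha>\<^sub>1 = \<bar>x\<^sub>0 \<bullet> x_min\<bar>\<close> by (simp add: abs_square_le_1)
  then have s: "0 \<le> s" and s2: "s\<^sup>2 = 1 - \<alpha>\<^sub>1\<^sup>2"
    by (simp_all add: s_def)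

  have norm_x1: "norm x\<^sub>1 = 1"
  proof -
    have "(norm x\<^sub>1)\<^sup>2 = 1"
      unfolding x1 using m mw \<open>norm w = 1\<close> s2 by (simp only: norm_sq_lincomb) simp
    then show ?thesis
      by (simp add: norm_eq_1 power2_norm_eq_inner)
  qed
  have orth: "x\<^sub>1 \<bullet> x\<^sub>0 = 0"
    unfolding x0 x1 using m mw \<open>norm w = 1\<close>
    by (simp add: inner_add_left inner_add_right inner_diff_left inner_diff_right inner_commute norm_eq_1)

  have Aorth: "(A\<^sub>I *v x_min) \<bullet> (A\<^sub>I *v w) = 0"
    by (rule least_right_singular_vector_image_orthogonal[OF min mw])
  have lincomb: "(norm (A\<^sub>I *v (a *\<^sub>R x_min + b *\<^sub>R w)))\<^sup>2 = a\<^sup>2 * p + b\<^sup>2 * q" for a b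
    using norm_sq_lincomb[of a "A\<^sub>I *v x_min" b "A\<^sub>I *v w"] Aorth
    by (simp add: matrix_vector_right_distrib matrix_vector_mult_scaleR p_def q_def)
  have norm_b: "norm b\<^sub>I = norm (A\<^sub>I *v x\<^sub>0)"
    by (simp add: \<open>b\<^sub>I = \<bar>A\<^sub>I *v x\<^sub>0\<bar>\<close> norm_abs_vec)
  have A0: "(norm b\<^sub>I)\<^sup>2 = \<alpha>\<^sub>1\<^sup>2 * p + s\<^sup>2 * q"
    unfolding norm_b x0 by (rule lincomb)
  have A1: "(norm (A\<^sub>I *v x\<^sub>1))\<^sup>2 = s\<^sup>2 * p + \<alpha>\<^sub>1\<^sup>2 * q"
    unfolding x1 by (simp only: lincomb power2_minus)
  have "0 \<le> p" "p \<le> q"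
    using min \<open>norm w = 1\<close> by (auto simp: p_def q_def least_right_singular_vector_def)
  then have "0 \<le> p + 2 * s ^ 4 * (q - p)"
    by simp
  also have "\<dots> = (2 - \<alpha>\<^sub>1\<^sup>2) * (norm b\<^sub>I)\<^sup>2 - (1 - \<alpha>\<^sub>1\<^sup>2) * (norm (A\<^sub>I *v x\<^sub>1))\<^sup>2"
    unfolding A0 A1 using s2 by algebra
  finally have main: "(1 - \<alpha>\<^sub>1\<^sup>2) * (norm (A\<^sub>I *v x\<^sub>1))\<^sup>2 \<le> (2 - \<alpha>\<^sub>1\<^sup>2) * (norm b\<^sub>I)\<^sup>2"
    by simp

  have quotient: "(1 - \<alpha>\<^sub>1\<^sup>2) / (2 - \<alpha>\<^sub>1\<^sup>2) \<le> (norm b\<^sub>I)\<^sup>2 * norm (A\<^sub>I *v x\<^sub>1) powi (-2)"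
    if "A\<^sub>I *v x\<^sub>1 \<noteq> 0"
  proof -
    have "(1 - \<alpha>\<^sub>1\<^sup>2) / (2 - \<alpha>\<^sub>1\<^sup>2) \<le> (norm b\<^sub>I)\<^sup>2 / (norm (A\<^sub>I *v x\<^sub>1))\<^sup>2"
      using main that \<open>\<alpha>\<^sub>1\<^sup>2 \<le> 1\<close> by (simp add: divide_le_eq le_divide_eq mult.commute)
    then show ?thesis
      by (simp add: power_int_minus divide_inverse)
  qed

  let ?S = "spectral_norm (outer x\<^sub>0 x\<^sub>0 - outer x_min x_min)"
  have "?S \<le> s"
    unfolding x0 using m mw \<open>norm w = 1\<close> s s2 by (intro spectral_norm_outer_diff_le) simp_all
  moreover have "0 \<le> ?S"
    unfolding spectral_norm_def by (intro onorm_pos_le matrix_vector_mul_bounded_linear)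
  ultimately have "?S\<^sup>2 \<le> s\<^sup>2"
    by (intro power_mono)
  then have "1 / 2 * ?S\<^sup>2 \<le> (1 - \<alpha>\<^sub>1\<^sup>2) / 2"
    using s2 by simp
  also have "\<dots> \<le> (1 - \<alpha>\<^sub>1\<^sup>2) / (2 - \<alpha>\<^sub>1\<^sup>2)"
    using \<open>\<alpha>\<^sub>1\<^sup>2 \<le> 1\<close> by (intro divide_left_mono) simp_all
  finally show ?thesis
    using norm_b norm_x1 orth main quotient by blast
qed

end
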